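(* Let $p$ be a prime such that $3$ divides $p-1$ and let $x_1,x_2,x_3\in\mathbb F_p$ be distinct. Let $\Gamma(x_1,x_2,x_3)$ be the projective closure of the affine curve $y^3=(t-x_1)(t-x_2)(t-x_3)^2$ over $\mathbb F_p$. Then for $j=1,2,3$, $$\int_{\Gamma(x_1,x_2,x_3)}\frac1{t-x_j}=-\,b_j^{p-1}(x_1,x_2,x_3)-\,c_j^{p-1}(x_1,x_2,x_3),$$ where $b_j^{p-1}$ and $c_j^{p-1}$ are the polynomials defined in the context.
   Context: For a rational function $h$ on $\Gamma=\Gamma(x_1,x_2,x_3)$ with values in $\mathbb F_p$, the integral $\int_{\Gamma}h$ is the sum $\sum h(P)\in\mathbb F_p$ over all $\mathbb F_p$-points $P$ of $\Gamma$ at which $h$ is defined (regular); the points at which $h$ is not defined are omitted. The projective closure is taken in the projective plane; the curve has one point at infinity. Consider the expansions in powers of $t$ $$(t-z_1)^{\frac{p-1}3}(t-z_2)^{\frac{p-1}3}(t-z_3)^{2\frac{p-1}3}\Big(\frac1{t-z_1},\frac1{t-z_2},\frac1{t-z_3}\Big)=\sum_i\bar b^{\,i}(z_1,z_2,z_3)\,t^i,$$ $$(t-z_1)^{2\frac{p-1}3}(t-z_2)^{2\frac{p-1}3}(t-z_3)^{\frac{p-1}3}\Big(\frac1{t-z_1},\frac1{t-z_2},\frac1{t-z_3}\Big)=\sum_i\bar c^{\,i}(z_1,z_2,z_3)\,t^i,$$ where $\bar b^{\,i}=(\bar b^{\,i}_1,\bar b^{\,i}_2,\bar b^{\,i}_3)$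 and $\bar c^{\,i}=(\bar c^{\,i}_1,\bar c^{\,i}_2,\bar c^{\,i}_3)$ are vectors of polynomials with integer coefficients. Let $b^i=(b^i_1,b^i_2,b^i_3)$ and $c^i=(c^i_1,c^i_2,c^i_3)$ in $(\mathbb F_p[z_1,z_2,z_3])^3$ be their reductions modulo $p$; here $i$ is a superscript index, and $b^{p-1}_j$, $c^{p-1}_j$ are the $j$-th coordinates for $i=p-1$. (Up to products of powers of differences $z_a-z_b$, the vectors $(b_j^{p-1})_j$ and $(c_j^{p-1})_j$ are solutions of KZ equations modulo $p$ with $n=3$, $\kappa=3$ and $(m_1,m_2,m_3)=(1,1,2)$, respectively $(2,2,1)$.) *)

theory Defs
  imports
    "HOL-Computational_Algebra.Polynomial"
    "Berlekamp_Zassenhaus.Finite_Field"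
begin

text \<open>
  Polynomials in three variables over \<open>R\<close> are elements of \<open>R[u1][u2][u3]\<close>, i.e. of type
  \<open>'a poly poly poly\<close>; the innermost layer belongs to the first variable.
  Polynomials in the affine coordinates \<open>t, y\<close> are elements of \<open>R[t][y]\<close>.
\<close>

definition var3 :: "nat \<Rightarrow> 'a::comm_ring_1 poly poly poly" where
  "var3 a = (if a = 1 then [:[:[:0, 1:]:]:] else if a = 2 then [:[:0, 1:]:] else [:0, 1:])"

definition eval3 :: "'a::comm_ring_1 poly poly poly \<Rightarrow> 'a \<times> 'a \<times> 'a \<Rightarrow> 'a" where
  "eval3 q = (\<lambda>(u1, u2, u3). poly (poly (poly q [:[:u3:]:]) [:u2:]) u1)"

abbreviation coeff2 :: "'a::zero poly poly \<Rightarrow> nat \<Rightarrow> nat \<Rightarrow> 'a" where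
  "coeff2 f i j \<equiv> coeff (coeff f j) i"

abbreviation coeff3 :: "'a::zero poly poly poly \<Rightarrow> nat \<Rightarrow> nat \<Rightarrow> nat \<Rightarrow> 'a" where
  "coeff3 q i j k \<equiv> coeff (coeff (coeff q k) j) i"

definition homogeneous3 :: "nat \<Rightarrow> 'a::comm_ring_1 poly poly poly \<Rightarrow> bool" where
  "homogeneous3 d q \<longleftrightarrow> (\<forall>i j k. coeff3 q i j k \<noteq> 0 \<longrightarrow> i + j + k = d)"


section \<open>Projective closures of affine plane curves\<close>

definition total_degree2 :: "'a::comm_ring_1 poly poly \<Rightarrow> nat" where
  "total_degree2 f = Max {i + j | i j. coeff2 f i j \<noteq> 0}"

text \<open>
  Homogeneous coordinates are \<open>[T : Y : W]\<close> with \<open>t = T / W\<close> and \<open>y = Y / W\<close>, so that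
  dehomogenization of \<open>q\<close> is \<open>poly q 1\<close> (setting \<open>W = 1\<close>).
\<close>

definition homogenize :: "'a::comm_ring_1 poly poly \<Rightarrow> 'a poly poly poly" where
  "homogenize f =
     (\<Sum>j\<le>degree f. \<Sum>i\<le>degree (coeff f j).
        monom (monom (monom (coeff2 f i j) i) j) (total_degree2 f - i - j))"

definition proj_rel :: "(('a::field \<times> 'a \<times> 'a) \<times> ('a \<times> 'a \<times> 'a)) set" where
  "proj_rel = {((a, b, c), (a', b', c')) | a b c a' b' c'.
     (a, b, c) \<noteq> (0, 0, 0) \<and>
     (\<exists>s. s \<noteq> 0 \<and> a' = s * a \<and> b' = s * b \<and> c' = s * c)}"

definition proj_plane :: "('a::field \<times> 'a \<times> 'a) set set" where
  "proj_plane = {v. v \<noteq> (0, 0, 0)} // proj_rel"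

text \<open>
  The points, rational over the ground field, of the projective closure of the affine plane
  curve \<open>f = 0\<close>.
\<close>

definition closure_points :: "'a::field poly poly \<Rightarrow> ('a \<times> 'a \<times> 'a) set set" where
  "closure_points f = {P \<in> proj_plane. \<forall>v\<in>P. eval3 (homogenize f) v = 0}"

text \<open>
  For irreducible \<open>f\<close> the function field of the curve is the field of fractions of
  \<open>R[t, y] / (f)\<close>. A rational function is given by a pair \<open>(g, h)\<close>, meaning \<open>g / h\<close>, of
  polynomials in \<open>t, y\<close> with \<open>h\<close> not divisible by \<open>f\<close>. It is regular at \<open>P\<close> if it is the
  restriction of a quotient \<open>G / H\<close> of homogeneous polynomials of equal degree
  with \<open>H\<close> nonzero at \<open>P\<close>; its value at \<open>P\<close> is then that of \<open>G / H\<close>.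
\<close>

type_synonym 'a rational_function = "'a poly poly \<times> 'a poly poly"

definition has_value_at ::
  "'a::field poly poly \<Rightarrow> 'a rational_function \<Rightarrow> ('a \<times> 'a \<times> 'a) set \<Rightarrow> 'a \<Rightarrow> bool" where
  "has_value_at f r P c \<longleftrightarrow>
     (\<exists>d G H. homogeneous3 d G \<and> homogeneous3 d H \<and>
        f dvd fst r * poly H 1 - poly G 1 * snd r \<and>
        (\<forall>v\<in>P. eval3 H v \<noteq> 0 \<and> c = eval3 G v / eval3 H v))"

definition regular_at ::
  "'a::field poly poly \<Rightarrow> 'a rational_function \<Rightarrow> ('a \<times> 'a \<times> 'a) set \<Rightarrow> bool" where
  "regular_at f r P \<longleftrightarrow> (\<exists>c. has_value_at f r P c)"

definition value_at ::
  "'a::field poly poly \<Rightarrow> 'a rational_function \<Rightarrow> ('a \<times> 'a \<times> 'a) set \<Rightarrow> 'a" where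
  "value_at f r P = (THE c. has_value_at f r P c)"

definition curve_integral :: "'a::field poly poly \<Rightarrow> 'a rational_function \<Rightarrow> 'a" where
  "curve_integral f r = (\<Sum>P\<in>{P \<in> closure_points f. regular_at f r P}. value_at f r P)"


section \<open>The curve and the functions \<open>1 / (t - x j)\<close>\<close>

definition t_minus :: "'a::comm_ring_1 \<Rightarrow> 'a poly poly" where
  "t_minus c = [:[:- c, 1:]:]"

definition curve_eq :: "(nat \<Rightarrow> 'a::comm_ring_1) \<Rightarrow> 'a poly poly" where
  "curve_eq x = [:0, 1:] ^ 3 - t_minus (x 1) * t_minus (x 2) * t_minus (x 3) ^ 2"

definition inverse_t_minus :: "'a::comm_ring_1 \<Rightarrow> 'a rational_function" where
  "inverse_t_minus c = (1, t_minus c)"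


section \<open>The polynomials \<open>kz_b\<close> and \<open>kz_c\<close>\<close>

text \<open>
  Polynomials in \<open>t\<close> over \<open>\<int>[z1, z2, z3]\<close>. All exponents are positive in the case of interest
  (\<open>p\<close> a prime with \<open>3 dvd p - 1\<close>), so the divisions by \<open>t - z j\<close> are exact.
\<close>

abbreviation t_minus_z :: "nat \<Rightarrow> int poly poly poly poly" where
  "t_minus_z a \<equiv> [:- var3 a, 1:]"

definition b_bar :: "nat \<Rightarrow> nat \<Rightarrow> nat \<Rightarrow> int poly poly poly" where
  "b_bar p i j = coeff
     ((t_minus_z 1 ^ ((p - 1) div 3) * t_minus_z 2 ^ ((p - 1) div 3)
        * t_minus_z 3 ^ (2 * ((p - 1) div 3))) div t_minus_z j) i"

definition c_bar :: "nat \<Rightarrow> nat \<Rightarrow> nat \<Rightarrow> int poly poly poly" where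
  "c_bar p i j = coeff
     ((t_minus_z 1 ^ (2 * ((p - 1) div 3)) * t_minus_z 2 ^ (2 * ((p - 1) div 3))
        * t_minus_z 3 ^ ((p - 1) div 3)) div t_minus_z j) i"

definition reduce_mod :: "int poly poly poly \<Rightarrow> 'a::prime_card mod_ring poly poly poly" where
  "reduce_mod = map_poly (map_poly (map_poly of_int))"

text \<open>The type \<open>'a mod_ring\<close> is the field with \<open>p = CARD('a)\<close> elements.\<close>

definition kz_b :: "nat \<Rightarrow> nat \<Rightarrow> 'a::prime_card mod_ring poly poly poly" where
  "kz_b i j = reduce_mod (b_bar CARD('a) i j)"

definition kz_c :: "nat \<Rightarrow> nat \<Rightarrow> 'a::prime_card mod_ring poly poly poly" where
  "kz_c i j = reduce_mod (c_bar CARD('a) i j)"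

end

theory Submission
  imports Defs
begin

text \<open>
  Let \<open>q = (t - x1) (t - x2) (t - x3)\<^sup>2\<close> and \<open>r = (p - 1) / 3\<close>. The integral is a sum over the
  affine line. An affine point \<open>(a, b)\<close> of \<open>\<Gamma>\<close> with \<open>a \<noteq> x j\<close> contributes \<open>1 / (a - x j)\<close>; at the
  points with \<open>a = x j\<close> the function is not regular (\<open>has_value_at_affine_point\<close>); at the
  point at infinity it vanishes (\<open>value_at_infinite_point\<close>). Hence, with the convention
  \<open>1 / 0 = 0\<close>, the integral is the sum over all \<open>a\<close> of \<open>N(a) / (a - x j)\<close>, where \<open>N(a)\<close> is the
  number of cube roots of \<open>q(a)\<close> (\<open>curve_integral_cubic_cover\<close>).

  Modulo \<open>p\<close> the number of cube roots of \<open>c\<close> is \<open>1 + c ^ r + c ^ (2 r)\<close> (\<open>card_cube_roots\<close>), which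
  splits the integral into three sums. The sum of all \<open>1 / (a - x j)\<close> is zero. By Fermat's
  little theorem, \<open>q(a) ^ r\<close> and \<open>q(a) ^ (2 r)\<close> are the values at \<open>a\<close> of the two products of
  powers of \<open>t - x i\<close> that define \<open>b\<close> and \<open>c\<close>: in the second one \<open>(a - x3) ^ (4 r)\<close> is
  \<open>(a - x3) ^ r\<close> because \<open>3 r = p - 1\<close>. Finally, the sum over \<open>a\<close> of the values of a polynomial of
  degree less than \<open>2 (p - 1)\<close> is minus its coefficient at \<open>t ^ (p - 1)\<close>
  (\<open>poly_sum_mod_ring\<close>); applied to the two products divided by \<open>t - x j\<close>, this gives the
  two coefficients of the theorem (\<open>sum_linear_product_div\<close>).

  The behaviour at infinity is the only point where the algebraic definition of a value
  takes work. There \<open>t\<close> has a pole of order 3 and \<open>y\<close> one of order 4; instead of a local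
  parameter, the proof grades polynomials in \<open>t, y\<close> by these weights and compares leading
  forms.
\<close>

section \<open>Power sums over a prime field\<close>

lemma fermat_mod_ring:
  fixes a :: "'a::prime_card mod_ring"
  assumes "a \<noteq> 0"
  shows "a ^ (CARD('a) - 1) = 1"
proof -
  have "CARD('a) > 1"
    using prime_card prime_gt_1_nat by blast
  hence "CARD('a) - 1 = Suc (nat (int CARD('a) - 2))"
    by simp
  hence "a ^ (CARD('a) - 1) = inverse a * a"
    using assms by (simp add: inverse_mod_ring_def)
  thus ?thesis
    using assms by simp
qed

lemma power_eq_power_mod:
  fixes a :: "'a::prime_card mod_ring"
  assumes "a \<noteq> 0"
  shows "a ^ m = a ^ (m mod (CARD('a) - 1))"
proof -
  have "a ^ m = a ^ ((CARD('a) - 1) * (m div (CARD('a) - 1)) + m mod (CARD('a) - 1))"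
    by simp
  also have "\<dots> = a ^ (m mod (CARD('a) - 1))"
    unfolding power_add power_mult fermat_mod_ring[OF assms] by simp
  finally show ?thesis .
qed

text \<open>
  Otherwise every nonzero element would be a root of \<open>X ^ k - 1\<close>, where \<open>k\<close> is the residue of
  \<open>m\<close> modulo \<open>p - 1\<close>: too many roots for its degree. This replaces the choice of a primitive
  root.
\<close>

lemma exists_power_neq_1:
  assumes "\<not> CARD('a::prime_card) - 1 dvd m"
  obtains g :: "'a::prime_card mod_ring" where "g \<noteq> 0" "g ^ m \<noteq> 1"
proof (rule ccontr)
  assume "\<not> thesis"
  hence all1: "g ^ m = 1" if "g \<noteq> 0" for g :: "'a mod_ring"
    using that \<open>\<And>g. g \<noteq> 0 \<Longrightarrow> g ^ m \<noteq> 1 \<Longrightarrow> thesis\<close> by blast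
  define k where "k = m mod (CARD('a) - 1)"
  have p: "CARD('a) > 1"
    using prime_card prime_gt_1_nat by blast
  have k: "0 < k" "k < CARD('a) - 1"
    using assms p by (auto simp: k_def dvd_eq_mod_eq_0)
  define q :: "'a mod_ring poly" where "q = monom 1 k - 1"
  have "coeff q k = 1"
    using k by (simp add: q_def)
  hence "q \<noteq> 0"
    by auto
  have "degree q \<le> k"
    unfolding q_def by (intro degree_diff_le) (auto simp: degree_monom_le)
  have "g ^ k = 1" if "g \<noteq> 0" for g :: "'a mod_ring"
    using all1[OF that] power_eq_power_mod[OF that, of m] by (simp add: k_def)
  hence "UNIV - {0} \<subseteq> {g. poly q g = 0}"
    by (auto simp: q_def poly_monom)
  hence "card (UNIV - {0 :: 'a mod_ring}) \<le> card {g. poly q g = 0}"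
    by (intro card_mono) auto
  also have "\<dots> \<le> k"
    using card_poly_roots_bound[OF \<open>q \<noteq> 0\<close>] \<open>degree q \<le> k\<close> by simp
  finally show False
    using k by (simp add: card_Diff_singleton)
qed

text \<open>
  Multiplication by \<open>g\<close> with \<open>g ^ m \<noteq> 1\<close> permutes the field and scales the sum by \<open>g ^ m\<close>, which
  forces the sum to vanish. For \<open>m = 0\<close> the convention \<open>0 ^ 0 = 1\<close> makes the sum equal to
  \<open>p = 0\<close>.
\<close>

lemma power_sum_mod_ring:
  "(\<Sum>a\<in>UNIV. (a :: 'a::prime_card mod_ring) ^ m) =
     (if 0 < m \<and> CARD('a) - 1 dvd m then -1 else 0)"
proof (cases "CARD('a) - 1 dvd m")
  case True
  have p: "CARD('a) \<ge> 1"
    by (simp add: Suc_leI)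
  show ?thesis
  proof (cases "m = 0")
    case True
    thus ?thesis by simp
  next
    case False
    have "(\<Sum>a\<in>UNIV. (a :: 'a mod_ring) ^ m) = (\<Sum>a\<in>UNIV - {0}. a ^ m)"
      using False by (intro sum.mono_neutral_right) auto
    also have "\<dots> = (\<Sum>a\<in>UNIV - {0 :: 'a mod_ring}. 1)"
    proof (intro sum.cong refl)
      fix a :: "'a mod_ring"
      assume "a \<in> UNIV - {0}"
      thus "a ^ m = 1"
        using True power_eq_power_mod[of a m] by (simp only: dvd_eq_mod_eq_0) simp
    qed
    also have "\<dots> = of_nat (CARD('a) - 1)"
      by (simp add: card_Diff_singleton)
    also have "\<dots> = -1"
      using p by (simp add: of_nat_diff)
    finally show ?thesis
      using False True by simp
  qed
next
  case False
  obtain g :: "'a mod_ring" where g: "g \<noteq> 0" "g ^ m \<noteq> 1"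
    using exists_power_neq_1[OF False] .
  have "(\<Sum>a\<in>UNIV. a ^ m) = (\<Sum>a\<in>UNIV. (g * a) ^ m)"
    by (rule sum.reindex_bij_witness[of _ "\<lambda>a. g * a" "\<lambda>a. a / g"]) (use g in auto)
  also have "\<dots> = g ^ m * (\<Sum>a\<in>UNIV. a ^ m)"
    by (simp add: power_mult_distrib sum_distrib_left)
  finally have "(\<Sum>a\<in>UNIV. a ^ m) = (0 :: 'a mod_ring)"
    using g by (metis mult_cancel_right1)
  with False show ?thesis
    by simp
qed

lemma sum_inverse_mod_ring:
  fixes c :: "'a::prime_card mod_ring"
  assumes "CARD('a) > 2"
  shows "(\<Sum>a\<in>UNIV. 1 / (a - c)) = 0"
proof -
  have "(\<Sum>a\<in>UNIV. 1 / (a - c)) = (\<Sum>a\<in>UNIV. 1 / a)"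
    by (rule sum.reindex_bij_witness[of _ "\<lambda>a. a + c" "\<lambda>a. a - c"]) auto
  also have "\<dots> = (\<Sum>a :: 'a mod_ring\<in>UNIV. a ^ (CARD('a) - 2))"
  proof (intro sum.cong refl)
    fix a :: "'a mod_ring"
    have "nat (int CARD('a) - 2) = CARD('a) - 2"
      by simp
    thus "1 / a = a ^ (CARD('a) - 2)"
      using assms by (cases "a = 0") (simp_all add: inverse_mod_ring_def divide_inverse)
  qed
  also have "\<not> CARD('a) - 1 dvd CARD('a) - 2"
    using assms by (auto dest!: dvd_imp_le)
  hence "(\<Sum>a :: 'a mod_ring\<in>UNIV. a ^ (CARD('a) - 2)) = 0"
    by (simp add: power_sum_mod_ring)
  finally show ?thesis .
qed

text \<open>
  In this range of degrees, \<open>p - 1\<close> is the only exponent with a nonzero power sum.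
\<close>

lemma poly_sum_mod_ring:
  fixes f :: "'a::prime_card mod_ring poly"
  assumes "degree f < 2 * (CARD('a) - 1)"
  shows "(\<Sum>a\<in>UNIV. poly f a) = - coeff f (CARD('a) - 1)"
proof -
  define n where "n = CARD('a) - 1"
  have p: "n > 0"
    using prime_card[where ?'a = 'a] prime_gt_1_nat by (auto simp: n_def)
  have "(\<Sum>a\<in>UNIV. poly f a) = (\<Sum>i\<le>degree f. coeff f i * (\<Sum>a\<in>UNIV. a ^ i))"
    by (simp add: poly_altdef sum_distrib_left) (rule sum.swap)
  also have "\<dots> = (\<Sum>i\<le>degree f. if i = n then - coeff f i else 0)"
  proof (intro sum.cong refl)
    fix i
    assume "i \<in> {..degree f}"
    hence "i < 2 * n"
      using assms by (auto simp: n_def)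
    have "0 < i \<and> n dvd i \<longleftrightarrow> i = n"
    proof
      assume "0 < i \<and> n dvd i"
      then obtain k where "i = n * k" "0 < k"
        by (auto elim!: dvdE)
      with \<open>i < 2 * n\<close> have "k < 2"
        by (metis mult.commute mult_less_cancel2)
      with \<open>0 < k\<close> \<open>i = n * k\<close> show "i = n"
        by simp
    qed (use p in auto)
    thus "coeff f i * (\<Sum>a\<in>UNIV. a ^ i) = (if i = n then - coeff f i else 0)"
      unfolding power_sum_mod_ring n_def[symmetric] by simp
  qed
  also have "\<dots> = - coeff f n"
    by (simp add: coeff_eq_0)
  finally show ?thesis
    by (simp add: n_def)
qed

section \<open>Counting cube roots\<close>

text \<open>
  The sum is \<open>(u ^ p - c ^ p) / (u - c) = 1\<close> if \<open>u \<noteq> c\<close>, by Fermat's little theorem, and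
  \<open>p u ^ (p - 1) = 0\<close> if \<open>u = c\<close>.
\<close>

lemma indicator_eq_geometric_sum:
  fixes u c :: "'a::prime_card mod_ring"
  shows "(if u = c then 1 else 0) = 1 - (\<Sum>k<CARD('a). u ^ k * c ^ (CARD('a) - 1 - k))"
proof -
  obtain n where n: "CARD('a) = Suc n"
    by (metis prime_card not0_implies_Suc not_prime_0)
  have "n \<noteq> 0"
    using n prime_card[where ?'a = 'a] not_prime_1 by (metis One_nat_def)
  have fermat: "a ^ Suc n = a" for a :: "'a mod_ring"
    using fermat_mod_ring[of a] n by (cases "a = 0") auto
  show ?thesis
  proof (cases "u = c")
    case True
    have "(\<Sum>k<Suc n. u ^ k * c ^ (n - k)) = (\<Sum>k<Suc n. u ^ n)"
      using True by (intro sum.cong) (auto simp flip: power_add)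
    also have "\<dots> = of_nat (CARD('a)) * u ^ n"
      unfolding n by simp
    also have "\<dots> = 0"
      by simp
    finally show ?thesis
      using True n by simp
  next
    case False
    have "u - c = (u - c) * (\<Sum>k<Suc n. u ^ k * c ^ (n - k))"
      using diff_power_eq_sum[of u n c] unfolding fermat .
    hence "(\<Sum>k<Suc n. u ^ k * c ^ (n - k)) = 1"
      using False by simp
    thus ?thesis
      using False n by simp
  qed
qed

text \<open>
  Summing the polynomial form of the indicator of \<open>b ^ 3 = c\<close> over \<open>b\<close> leaves only the
  exponents \<open>3 k\<close> of \<open>b\<close> that are positive multiples of \<open>p - 1 = 3 r\<close>. This covers \<open>c = 0\<close>
  without a separate argument.
\<close>

lemma card_cube_roots:
  fixes c :: "'a::prime_card mod_ring"
  assumes r: "CARD('a) - 1 = 3 * r"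
  shows "of_nat (card {b. b ^ 3 = c}) = 1 + c ^ r + c ^ (2 * r)"
proof -
  have "r > 0"
    using r prime_card[where ?'a = 'a] prime_gt_1_nat by (metis gr0I mult_0_right not_less zero_less_diff le_eq_less_or_eq)
  have p: "CARD('a) = Suc (3 * r)"
    using r prime_card[where ?'a = 'a] by (metis Suc_diff_1 prime_gt_0_nat)
  have "of_nat (card {b. b ^ 3 = c}) = (\<Sum>b\<in>UNIV. if b ^ 3 = c then 1 else (0 :: 'a mod_ring))"
    by (simp add: sum.If_cases)
  also have "\<dots> = (\<Sum>b\<in>UNIV. 1 - (\<Sum>k\<le>3 * r. b ^ (3 * k) * c ^ (3 * r - k)))"
    unfolding indicator_eq_geometric_sum by (simp add: p power_mult lessThan_Suc_atMost)
  also have "\<dots> = - (\<Sum>b\<in>UNIV. \<Sum>k\<le>3 * r. b ^ (3 * k) * c ^ (3 * r - k))"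
    by (simp add: sum_subtractf)
  also have "(\<Sum>b\<in>UNIV. \<Sum>k\<le>3 * r. b ^ (3 * k) * c ^ (3 * r - k)) =
      (\<Sum>k\<le>3 * r. (\<Sum>b\<in>UNIV. b ^ (3 * k)) * c ^ (3 * r - k))"
    unfolding sum_distrib_right by (rule sum.swap)
  also have "\<dots> = (\<Sum>k\<le>3 * r. if k \<in> {r, 2 * r, 3 * r} then - (c ^ (3 * r - k)) else 0)"
  proof (intro sum.cong refl)
    fix k
    assume "k \<in> {..3 * r}"
    have "0 < 3 * k \<and> 3 * r dvd 3 * k \<longleftrightarrow> 0 < k \<and> r dvd k"
      by simp
    also have "\<dots> \<longleftrightarrow> k \<in> {r, 2 * r, 3 * r}"
    proof
      assume "0 < k \<and> r dvd k"
      then obtain l where l: "k = l * r" "0 < l"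
        by (auto elim!: dvdE)
      with \<open>k \<in> {..3 * r}\<close> \<open>r > 0\<close> have "l \<le> 3"
        by simp
      with \<open>0 < l\<close> have "l = 1 \<or> l = 2 \<or> l = 3"
        by auto
      with l show "k \<in> {r, 2 * r, 3 * r}"
        by auto
    qed (use \<open>r > 0\<close> in auto)
    finally show "(\<Sum>b\<in>UNIV. b ^ (3 * k)) * c ^ (3 * r - k) =
        (if k \<in> {r, 2 * r, 3 * r} then - (c ^ (3 * r - k)) else 0)"
      unfolding power_sum_mod_ring r by auto
  qed
  also have "\<dots> = (\<Sum>k\<in>{r, 2 * r, 3 * r}. - (c ^ (3 * r - k)))"
  proof -
    have "{..3 * r} \<inter> {k. k \<in> {r, 2 * r, 3 * r}} = {r, 2 * r, 3 * r}"
      by auto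
    thus ?thesis
      by (simp add: sum.If_cases)
  qed
  also have "\<dots> = - (1 + c ^ r + c ^ (2 * r))"
    using \<open>r > 0\<close> by (simp add: algebra_simps)
  finally show ?thesis
    by simp
qed

section \<open>Products of powers of linear polynomials\<close>

text \<open>
  That this map is a ring homomorphism reduces the division over \<open>\<int>[z1, z2, z3]\<close> in
  \<open>b_bar\<close> and \<open>c_bar\<close> to one over the field.
\<close>

definition specialize :: "'a::prime_card mod_ring \<times> 'a mod_ring \<times> 'a mod_ring \<Rightarrow>
    int poly poly poly \<Rightarrow> 'a mod_ring" where
  "specialize u q = eval3 (reduce_mod q) u"

lemma comm_ring_hom_map_poly: "comm_ring_hom f \<Longrightarrow> comm_ring_hom (map_poly f)"
proof -
  assume "comm_ring_hom f"
  then interpret map_poly_comm_ring_hom f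
    by (simp add: map_poly_comm_ring_hom_def)
  show ?thesis ..
qed

lemma comm_ring_hom_compose:
  "comm_ring_hom f \<Longrightarrow> comm_ring_hom g \<Longrightarrow> comm_ring_hom (\<lambda>x. f (g x))"
proof -
  assume "comm_ring_hom f" "comm_ring_hom g"
  then interpret f: comm_ring_hom f + g: comm_ring_hom g
    by simp_all
  show ?thesis
    by unfold_locales (simp_all add: f.hom_add g.hom_add f.hom_mult g.hom_mult)
qed

lemma specialize_hom: "comm_ring_hom (specialize u)"
proof -
  obtain u1 u2 u3 where u: "u = (u1, u2, u3)"
    by (cases u)
  show ?thesis
    unfolding specialize_def eval3_def u prod.case reduce_mod_def
    by (rule comm_ring_hom_compose[OF poly_hom.comm_ring_hom_axioms
          comm_ring_hom_compose[OF poly_hom.comm_ring_hom_axioms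
          comm_ring_hom_compose[OF poly_hom.comm_ring_hom_axioms
          comm_ring_hom_map_poly[OF comm_ring_hom_map_poly[OF comm_ring_hom_map_poly[OF
            of_int_hom.comm_ring_hom_axioms]]]]]])
qed

lemma specialize_var3:
  assumes "i \<in> {1, 2, 3}"
  shows "specialize (x 1, x 2, x 3) (var3 i) = x i"
  using assms by (auto simp: specialize_def eval3_def reduce_mod_def var3_def map_poly_pCons)

definition linear_product :: "(nat \<Rightarrow> 'a::comm_ring_1) \<Rightarrow> (nat \<Rightarrow> nat) \<Rightarrow> 'a poly" where
  "linear_product z e = (\<Prod>i\<in>{1, 2, 3}. [:- z i, 1:] ^ e i)"

lemma degree_linear_product:
  fixes z :: "nat \<Rightarrow> 'a::idom"
  shows "degree (linear_product z e) = e 1 + e 2 + e 3"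
  by (simp add: linear_product_def degree_mult_eq degree_power_eq)

lemma lead_coeff_linear_product:
  fixes z :: "nat \<Rightarrow> 'a::idom"
  shows "lead_coeff (linear_product z e) = 1"
  by (simp add: linear_product_def lead_coeff_mult lead_coeff_power)

lemma poly_linear_product:
  "poly (linear_product z e) a = (\<Prod>i\<in>{1, 2, 3}. (a - z i) ^ e i)"
  by (simp add: linear_product_def)

lemma map_poly_linear_product:
  assumes "comm_ring_hom h"
  shows "map_poly h (linear_product z e) = linear_product (\<lambda>i. h (z i)) e"
proof -
  interpret h: comm_ring_hom h by fact
  interpret H: comm_ring_hom "map_poly h"
    by (rule comm_ring_hom_map_poly) fact
  show ?thesis
    by (simp add: linear_product_def H.hom_mult H.hom_power map_poly_pCons h.hom_uminus)
qed

text \<open>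
  The quotient by \<open>t - x j\<close> is a polynomial that agrees with the summand for \<open>a \<noteq> x j\<close>. As
  \<open>e j \<ge> 2\<close>, the quotient still vanishes at \<open>x j\<close>, where the summand is \<open>0 / 0 = 0\<close>; so the sum
  is one of values of a polynomial.
\<close>

lemma sum_linear_product_div:
  fixes x :: "nat \<Rightarrow> 'a::prime_card mod_ring"
  assumes j: "j \<in> {1, 2, 3}" and e: "e j \<ge> 2" and deg: "e 1 + e 2 + e 3 \<le> 2 * (CARD('a) - 1)"
  shows "(\<Sum>a\<in>UNIV. poly (linear_product x e) a / (a - x j)) =
    - specialize (x 1, x 2, x 3)
        (coeff (linear_product var3 e div [:- var3 j, 1:]) (CARD('a) - 1))"
proof -
  define h where "h = specialize (x 1, x 2, x 3)"
  interpret h: comm_ring_hom h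
    unfolding h_def by (rule specialize_hom)
  interpret H: comm_ring_hom "map_poly h"
    by (rule comm_ring_hom_map_poly) (rule h.comm_ring_hom_axioms)
  let ?P = "linear_product var3 e :: int poly poly poly poly"
  let ?l = "[:- var3 j, 1:] :: int poly poly poly poly"
  have "?l ^ e j dvd ?P"
    using j unfolding linear_product_def by (intro dvd_prodI) auto
  hence "?l ^ 2 dvd ?P"
    using e by (meson dvd_trans le_imp_power_dvd)
  then obtain R where R: "?P = ?l ^ 2 * R" ..
  define B where "B = [:- x j, 1:] * map_poly h R"
  have hvar: "h (var3 i) = x i" if "i \<in> {1, 2, 3}" for i
    unfolding h_def by (rule specialize_var3) fact
  have "?P div ?l = ?l * R"
    unfolding R power2_eq_square mult.assoc by (rule nonzero_mult_div_cancel_left) simp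
  hence "map_poly h (?P div ?l) = B"
    by (simp only: H.hom_mult B_def) (simp add: hvar[OF j] map_poly_pCons h.hom_uminus)
  hence coeff_B: "h (coeff (?P div ?l) n) = coeff B n" for n
    by (metis coeff_map_poly h.hom_zero)
  have "linear_product x e = map_poly h ?P"
    by (simp add: map_poly_linear_product[OF h.comm_ring_hom_axioms])
       (simp add: linear_product_def hvar)
  also have "\<dots> = map_poly h ?l * (map_poly h ?l * map_poly h R)"
    by (simp only: R H.hom_mult power2_eq_square mult.assoc)
  also have "map_poly h ?l = [:- x j, 1:]"
    by (simp add: hvar[OF j] map_poly_pCons h.hom_uminus)
  finally have P: "linear_product x e = [:- x j, 1:] * B"
    by (simp only: B_def)
  have deg_P: "degree (linear_product x e) = e 1 + e 2 + e 3"
    by (rule degree_linear_product)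
  have "degree B < 2 * (CARD('a) - 1)"
  proof (cases "B = 0")
    case True
    thus ?thesis
      using e j deg by auto
  next
    case False
    hence "degree (linear_product x e) = Suc (degree B)"
      unfolding P by (subst degree_mult_eq) auto
    thus ?thesis
      using deg deg_P by simp
  qed
  have "poly (linear_product x e) a / (a - x j) = poly B a" for a
  proof -
    have "poly (linear_product x e) a = (a - x j) * poly B a"
      by (simp only: P poly_mult) simp
    moreover have "poly B (x j) = 0"
      by (simp add: B_def)
    ultimately show ?thesis
      by (cases "a = x j") simp_all
  qed
  thus ?thesis
    using poly_sum_mod_ring[OF \<open>degree B < _\<close>] coeff_B by (simp add: h_def)
qed

section \<open>Rational points of the projective closure\<close>

definition affine_point :: "'a::field \<Rightarrow> 'a \<Rightarrow> ('a \<times> 'a \<times> 'a) set" where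
  "affine_point a b = proj_rel `` {(a, b, 1)}"

definition infinite_point :: "('a::field \<times> 'a \<times> 'a) set" where
  "infinite_point = proj_rel `` {(0, 1, 0)}"

lemma affine_point_eq: "affine_point a b = {(s * a, s * b, s) | s. s \<noteq> 0}"
  by (auto simp: affine_point_def proj_rel_def)

lemma infinite_point_eq: "infinite_point = {(0, s, 0) | s. s \<noteq> 0}"
  by (auto simp: infinite_point_def proj_rel_def)

lemma affine_point_inject: "affine_point a b = affine_point a' b' \<longleftrightarrow> a = a' \<and> b = b'"
proof
  assume "affine_point a b = affine_point a' b'"
  moreover have "(a, b, 1) \<in> affine_point a b"
    by (auto simp: affine_point_eq)
  ultimately have "(a, b, 1) \<in> affine_point a' b'"
    by simp
  thus "a = a' \<and> b = b'"
    by (auto simp: affine_point_eq)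
qed auto

lemma affine_neq_infinite_point: "affine_point a b \<noteq> infinite_point"
proof
  assume "affine_point a b = infinite_point"
  moreover have "(a, b, 1) \<in> affine_point a b"
    by (auto simp: affine_point_eq)
  ultimately show False
    by (auto simp: infinite_point_eq)
qed

text \<open>
  The second case keeps a representative, so that the equation of a curve can be evaluated
  there to exclude \<open>u \<noteq> 0\<close>.
\<close>

lemma proj_plane_cases:
  assumes "P \<in> proj_plane"
  obtains (affine) a b where "P = affine_point a b"
    | (infinite) u v where "(u, v, 0) \<in> P" "u \<noteq> 0 \<or> P = infinite_point"
proof -
  obtain u v w where uvw: "(u, v, w) \<noteq> (0, 0, 0)" and P: "P = proj_rel `` {(u, v, w)}"
    using assms by (auto simp: proj_plane_def elim!: quotientE)
  have P_eq: "P = {(s * u, s * v, s * w) | s. s \<noteq> 0}"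
    using uvw by (auto simp: P proj_rel_def)
  show thesis
  proof (cases "w = 0")
    case False
    have "P = affine_point (u / w) (v / w)"
      unfolding P_eq affine_point_eq
    proof (intro equalityI subsetI)
      fix z assume "z \<in> {(s * u, s * v, s * w) |s. s \<noteq> 0}"
      then obtain s where "s \<noteq> 0" "z = (s * u, s * v, s * w)"
        by blast
      hence "z = ((s * w) * (u / w), (s * w) * (v / w), s * w) \<and> s * w \<noteq> 0"
        using False by simp
      thus "z \<in> {(s * (u / w), s * (v / w), s) |s. s \<noteq> 0}"
        by blast
    next
      fix z assume "z \<in> {(s * (u / w), s * (v / w), s) |s. s \<noteq> 0}"
      then obtain s where "s \<noteq> 0" "z = (s * (u / w), s * (v / w), s)"
        by blast
      hence "z = ((s / w) * u, (s / w) * v, (s / w) * w) \<and> s / w \<noteq> 0"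
        using False by simp
      thus "z \<in> {(s * u, s * v, s * w) |s. s \<noteq> 0}"
        by blast
    qed
    thus thesis
      by (rule affine)
  next
    case True
    have "(u, v, 0) \<in> P"
      using True by (auto simp: P_eq intro!: exI[of _ 1])
    moreover have "P = infinite_point" if "u = 0"
    proof -
      have "v \<noteq> 0"
        using uvw True that by simp
      show ?thesis
        unfolding P_eq infinite_point_eq True that
      proof (intro equalityI subsetI)
        fix z :: "'a \<times> 'a \<times> 'a"
        assume "z \<in> {(0, s, 0) |s. s \<noteq> 0}"
        then obtain s where "s \<noteq> 0" "z = (0, s, 0)"
          by blast
        hence "z = ((s / v) * 0, (s / v) * v, (s / v) * 0) \<and> s / v \<noteq> 0"
          using \<open>v \<noteq> 0\<close> by simp
        thus "z \<in> {(s * 0, s * v, s * 0) |s. s \<noteq> 0}"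
          by blast
      next
        fix z :: "'a \<times> 'a \<times> 'a"
        assume "z \<in> {(s * 0, s * v, s * 0) |s. s \<noteq> 0}"
        then obtain s where "s \<noteq> 0" "z = (s * 0, s * v, s * 0)"
          by blast
        hence "z = (0, s * v, 0) \<and> s * v \<noteq> 0"
          using \<open>v \<noteq> 0\<close> by simp
        thus "z \<in> {(0, s, 0) |s. s \<noteq> 0}"
          by blast
      qed
    qed
    ultimately show thesis
      using infinite by blast
  qed
qed

lemma affine_point_in_proj_plane: "affine_point a b \<in> proj_plane"
  unfolding proj_plane_def affine_point_def by (rule quotientI) simp

lemma infinite_point_in_proj_plane: "infinite_point \<in> proj_plane"
  unfolding proj_plane_def infinite_point_def by (rule quotientI) simp

text \<open>The affine curve \<open>y ^ 3 = q(t)\<close>.\<close>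

abbreviation cubic_cover :: "'a::comm_ring_1 poly \<Rightarrow> 'a poly poly" where
  "cubic_cover q \<equiv> [:- q, 0, 0, 1:]"

lemma coeff_cubic_cover:
  "coeff (cubic_cover q) j = (if j = 0 then - q else if j = 3 then 1 else 0)"
  by (auto simp: coeff_pCons numeral_3_eq_3 split: nat.splits)

lemma poly_cubic_cover: "poly (poly (cubic_cover q) [:b:]) a = b ^ 3 - poly q a"
  by (simp add: power3_eq_cube)

lemma eval3_add: "eval3 (q + q') u = eval3 q u + eval3 q' u"
  by (cases u) (simp add: eval3_def)

lemma eval3_sum: "eval3 (sum f A) u = (\<Sum>i\<in>A. eval3 (f i) u)"
  by (cases u) (simp add: eval3_def poly_sum)

lemma eval3_monom: "eval3 (monom (monom (monom c i) j) k) (u, v, w) = c * u ^ i * v ^ j * w ^ k"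
  by (simp add: eval3_def poly_monom poly_power[symmetric])

lemma total_degree2_cubic_cover:
  fixes q :: "'a::field poly"
  assumes "degree q = 4"
  shows "total_degree2 (cubic_cover q) = 4"
  unfolding total_degree2_def
proof (rule Max_eqI)
  have *: "i + j \<le> 4" if nz: "coeff2 (cubic_cover q) i j \<noteq> 0" for i j
  proof -
    consider "j = 0" | "j = 3" "i = 0"
      using nz by (auto simp: coeff_cubic_cover coeff_1 split: if_splits)
    thus ?thesis
    proof cases
      case 1
      thus ?thesis
        using nz le_degree[of q i] assms by (simp add: coeff_cubic_cover)
    qed auto
  qed
  hence sub: "{i + j |i j. coeff2 (cubic_cover q) i j \<noteq> 0} \<subseteq> {..4}"
    by blast
  thus "\<And>n. n \<in> {i + j |i j. coeff2 (cubic_cover q) i j \<noteq> 0} \<Longrightarrow> n \<le> 4"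
    by blast
  from sub show "finite {i + j |i j. coeff2 (cubic_cover q) i j \<noteq> 0}"
    by (rule finite_subset) simp
  have "coeff2 (cubic_cover q) 4 0 \<noteq> 0"
    using assms by (metis coeff_cubic_cover coeff_minus degree_0 leading_coeff_0_iff
        neg_equal_0_iff_equal zero_neq_numeral)
  thus "4 \<in> {i + j |i j. coeff2 (cubic_cover q) i j \<noteq> 0}"
    by (intro CollectI exI[of _ 4] exI[of _ 0]) simp
qed

lemma eval3_homogenize_cubic_cover:
  fixes q :: "'a::field poly"
  assumes "degree q = 4"
  shows "eval3 (homogenize (cubic_cover q)) (u, v, w) =
    v ^ 3 * w - (\<Sum>i\<le>4. coeff q i * u ^ i * w ^ (4 - i))"
proof -
  have deg: "degree (cubic_cover q) = 3"
    by simp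
  have "{..3::nat} = {0, 1, 2, 3}"
    by auto
  moreover have "eval3 (monom (monom 1 3) 1) (u, v, w) = v ^ 3 * w"
    using eval3_monom[of 1 0 3 1 u v w] by simp
  ultimately show ?thesis
    unfolding homogenize_def total_degree2_cubic_cover[OF assms] deg
    by (simp add: coeff_cubic_cover eval3_sum eval3_add eval3_monom assms sum_negf)
qed

text \<open>
  On the line \<open>W = 0\<close> the homogeneous equation becomes \<open>T ^ 4 = 0\<close>, since the term \<open>Y ^ 3 W\<close>
  vanishes there.
\<close>

lemma closure_points_cubic_cover:
  fixes q :: "'a::field poly"
  assumes "degree q = 4"
  shows "closure_points (cubic_cover q) =
    insert infinite_point ((\<lambda>(a, b). affine_point a b) ` {(a, b). b ^ 3 = poly q a})"
proof -
  have eval_affine: "eval3 (homogenize (cubic_cover q)) (s * a, s * b, s) =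
      s ^ 4 * (b ^ 3 - poly q a)" for s a b
  proof -
    have "(\<Sum>i\<le>4. coeff q i * (s * a) ^ i * s ^ (4 - i)) = (\<Sum>i\<le>4. s ^ 4 * (coeff q i * a ^ i))"
    proof (intro sum.cong refl)
      fix i :: nat
      assume "i \<in> {..4}"
      hence "s ^ 4 = s ^ i * s ^ (4 - i)"
        by (simp flip: power_add)
      thus "coeff q i * (s * a) ^ i * s ^ (4 - i) = s ^ 4 * (coeff q i * a ^ i)"
        by (simp add: power_mult_distrib mult_ac)
    qed
    also have "\<dots> = s ^ 4 * poly q a"
      by (simp add: poly_altdef assms sum_distrib_left)
    finally show ?thesis
      unfolding eval3_homogenize_cubic_cover[OF assms]
      by (simp add: power_mult_distrib algebra_simps power4_eq_xxxx power3_eq_cube)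
  qed
  have eval_infinite: "eval3 (homogenize (cubic_cover q)) (u, v, 0) = - lead_coeff q * u ^ 4"
    for u v
  proof -
    have "(\<Sum>i\<le>4. coeff q i * u ^ i * 0 ^ (4 - i)) = (\<Sum>i\<in>{4}. coeff q i * u ^ i)"
      by (rule sum.mono_neutral_cong_right) (auto simp: power_0_left)
    thus ?thesis
      unfolding eval3_homogenize_cubic_cover[OF assms] by (simp add: assms)
  qed
  have "lead_coeff q \<noteq> 0"
    using assms by (metis degree_0 leading_coeff_0_iff zero_neq_numeral)
  show ?thesis
  proof (intro equalityI subsetI)
    fix P
    assume "P \<in> closure_points (cubic_cover q)"
    hence P: "P \<in> proj_plane" "\<And>v. v \<in> P \<Longrightarrow> eval3 (homogenize (cubic_cover q)) v = 0"
      by (auto simp: closure_points_def)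
    from P(1) show "P \<in> insert infinite_point
        ((\<lambda>(a, b). affine_point a b) ` {(a, b). b ^ 3 = poly q a})"
    proof (cases rule: proj_plane_cases)
      case (affine a b)
      hence "(1 * a, 1 * b, 1) \<in> P"
        by (auto simp: affine_point_eq intro!: exI[of _ 1])
      from P(2)[OF this] have "b ^ 3 = poly q a"
        unfolding eval_affine by simp
      with affine show ?thesis
        by auto
    next
      case (infinite u v)
      from P(2)[OF this(1)] have "u = 0"
        using \<open>lead_coeff q \<noteq> 0\<close> unfolding eval_infinite by simp
      with infinite show ?thesis
        by simp
    qed
  next
    fix P
    assume "P \<in> insert infinite_point
        ((\<lambda>(a, b). affine_point a b) ` {(a, b). b ^ 3 = poly q a})"
    then consider "P = infinite_point" | a b where "P = affine_point a b" "b ^ 3 = poly q a"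
      by auto
    thus "P \<in> closure_points (cubic_cover q)"
    proof cases
      case 1
      moreover have "eval3 (homogenize (cubic_cover q)) z = 0" if "z \<in> infinite_point" for z
        using that by (auto simp: infinite_point_eq eval_infinite)
      ultimately show ?thesis
        using infinite_point_in_proj_plane by (simp add: closure_points_def)
    next
      case (2 a b)
      moreover have "eval3 (homogenize (cubic_cover q)) z = 0" if "z \<in> affine_point a b" for z
        using that 2 by (auto simp: affine_point_eq eval_affine)
      ultimately show ?thesis
        using affine_point_in_proj_plane by (simp add: closure_points_def)
    qed
  qed
qed

section \<open>Values at affine points\<close>

lemma eval3_1: "eval3 q (a, b, 1) = poly (poly (poly q 1) [:b:]) a"
  by (simp add: eval3_def one_pCons)

text \<open>
  If \<open>G / H\<close> represents \<open>1 / (t - c)\<close>, then \<open>H = G (t - c)\<close> holds at every affine point of the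
  curve. For \<open>a = c\<close> this makes \<open>H\<close> vanish, so there is no value; for \<open>a \<noteq> c\<close> it determines the
  value, which is attained by \<open>W / (T - c W)\<close>.
\<close>

lemma has_value_at_affine_point:
  fixes q :: "'a::field poly"
  assumes "b ^ 3 = poly q a"
  shows "has_value_at (cubic_cover q) (inverse_t_minus c) (affine_point a b) v \<longleftrightarrow>
    a \<noteq> c \<and> v = 1 / (a - c)"
proof
  assume "has_value_at (cubic_cover q) (inverse_t_minus c) (affine_point a b) v"
  then obtain d G H where
    dvd: "cubic_cover q dvd poly H 1 - poly G 1 * t_minus c" and
    val: "\<And>z. z \<in> affine_point a b \<Longrightarrow> eval3 H z \<noteq> 0 \<and> v = eval3 G z / eval3 H z"
    by (auto simp: has_value_at_def inverse_t_minus_def)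
  have "(a, b, 1) \<in> affine_point a b"
    by (auto simp: affine_point_eq)
  from val[OF this] have H: "eval3 H (a, b, 1) \<noteq> 0" "v = eval3 G (a, b, 1) / eval3 H (a, b, 1)"
    by auto
  obtain K where "poly H 1 - poly G 1 * t_minus c = cubic_cover q * K"
    using dvd ..
  hence "poly (poly (poly H 1 - poly G 1 * t_minus c) [:b:]) a =
      poly (poly (cubic_cover q) [:b:]) a * poly (poly K [:b:]) a"
    by (simp only: poly_mult)
  hence "eval3 H (a, b, 1) = eval3 G (a, b, 1) * (a - c)"
    unfolding poly_cubic_cover using assms by (simp add: eval3_1 t_minus_def algebra_simps)
  with H show "a \<noteq> c \<and> v = 1 / (a - c)"
    by auto
next
  assume v: "a \<noteq> c \<and> v = 1 / (a - c)"
  define G :: "'a poly poly poly" where "G = monom (monom (monom 1 0) 0) 1"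
  define H :: "'a poly poly poly" where
    "H = monom (monom (monom 1 1) 0) 0 + monom (monom (monom (-c) 0) 0) 1"
  have "homogeneous3 1 G" "homogeneous3 1 H"
    by (auto simp: homogeneous3_def G_def H_def split: if_splits)
  moreover have "cubic_cover q dvd fst (inverse_t_minus c) * poly H 1 -
      poly G 1 * snd (inverse_t_minus c)"
  proof -
    have "poly H 1 = t_minus c" "poly G 1 = 1"
      by (simp_all add: G_def H_def poly_monom t_minus_def monom_0 monom_Suc one_pCons)
    thus ?thesis
      by (simp add: inverse_t_minus_def)
  qed
  moreover have "eval3 H z \<noteq> 0 \<and> v = eval3 G z / eval3 H z" if z: "z \<in> affine_point a b" for z
  proof -
    obtain s where "s \<noteq> 0" "z = (s * a, s * b, s)"
      using z by (auto simp: affine_point_eq)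
    moreover have "eval3 G (s * a, s * b, s) = s"
      unfolding G_def eval3_monom by simp
    moreover have "eval3 H (s * a, s * b, s) = s * (a - c)"
      unfolding H_def eval3_add eval3_monom by (simp add: algebra_simps)
    ultimately show ?thesis
      using v by simp
  qed
  ultimately show "has_value_at (cubic_cover q) (inverse_t_minus c) (affine_point a b) v"
    unfolding has_value_at_def by blast
qed

section \<open>The point at infinity\<close>

text \<open>
  The polynomial \<open>P(s ^ 3, Y s ^ 4)\<close> in \<open>R[Y][s]\<close>. Its degree in \<open>s\<close> is the weighted degree of
  \<open>P\<close> for which \<open>t\<close> has weight 3 and \<open>y\<close> has weight 4, their pole orders at infinity, and its
  leading coefficient is the leading form of \<open>P\<close> at \<open>t = 1, y = Y\<close>. The variable \<open>Y\<close> is kept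
  because the leading form of \<open>y ^ 3 - q(t)\<close> becomes zero at \<open>t = y = 1\<close>.
\<close>

definition weight_subst :: "'a::comm_ring_1 poly poly \<Rightarrow> 'a poly poly" where
  "weight_subst P =
     poly (map_poly (\<lambda>g. poly (map_poly (\<lambda>c. [:[:c:]:]) g) (monom 1 3)) P) (monom [:0, 1:] 4)"

lemma comm_ring_hom_poly_map_poly:
  assumes "comm_ring_hom h"
  shows "comm_ring_hom (\<lambda>g. poly (map_poly h g) u)"
proof -
  interpret h: map_poly_comm_ring_hom h
    using assms by (simp add: map_poly_comm_ring_hom_def)
  show ?thesis
    by unfold_locales (simp_all add: h.hom_add h.hom_mult)
qed

lemma weight_subst_hom: "comm_ring_hom (weight_subst :: 'a::comm_ring_1 poly poly \<Rightarrow> _)"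
proof -
  have "comm_ring_hom (\<lambda>c :: 'a. [:[:c:]:])"
    by unfold_locales (simp_all add: one_pCons)
  from comm_ring_hom_poly_map_poly[OF comm_ring_hom_poly_map_poly[OF this]]
  show ?thesis
    unfolding weight_subst_def[abs_def] .
qed

interpretation weight_subst: comm_ring_hom weight_subst
  by (rule weight_subst_hom)

lemma weight_subst_monom:
  "weight_subst (monom (monom c i) j) = monom (monom c j) (3 * i + 4 * j)"
proof -
  have "[:0, 1:] ^ j = (monom 1 j :: 'a poly)"
    by (simp add: monom_altdef)
  moreover have "[:c:] * monom 1 j = monom c j"
    by (simp add: smult_monom)
  ultimately show ?thesis
    by (simp add: weight_subst_def map_poly_monom poly_monom monom_power mult_monom
        flip: monom_0)
qed

lemma coeff_weight_subst:
  "coeff2 (weight_subst P) m n =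
     (if 4 * m \<le> n \<and> 3 dvd n - 4 * m then coeff2 P ((n - 4 * m) div 3) m else 0)"
proof -
  let ?M = "\<lambda>j i. monom (monom (coeff2 P i j) i) j"
  have P: "P = (\<Sum>j\<le>degree P. \<Sum>i\<le>degree (coeff P j). ?M j i)"
    by (simp add: poly_as_sum_of_monoms flip: monom_hom.hom_sum)
  define c where "c \<longleftrightarrow> 4 * m \<le> n \<and> 3 dvd n - 4 * m"
  define k where "k = (n - 4 * m) div 3"
  have "3 * i + 4 * j = n \<and> j = m \<longleftrightarrow> c \<and> j = m \<and> i = k" for i j
  proof (cases "4 * m \<le> n")
    case True
    then obtain l where "n = 4 * m + l"
      using le_Suc_ex by blast
    thus ?thesis
      by (auto simp: c_def k_def)
  qed (auto simp: c_def)
  moreover have "coeff2 (weight_subst (?M j i)) m n =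
      (if 3 * i + 4 * j = n \<and> j = m then coeff2 P i j else 0)" for i j
    by (simp add: weight_subst_monom)
  ultimately have "coeff2 (weight_subst (?M j i)) m n = (if c then coeff2 (?M j i) k m else 0)"
    for i j
    by simp
  hence "coeff2 (weight_subst (\<Sum>j\<le>degree P. \<Sum>i\<le>degree (coeff P j). ?M j i)) m n =
      (if c then coeff2 (\<Sum>j\<le>degree P. \<Sum>i\<le>degree (coeff P j). ?M j i) k m else 0)"
    by (simp add: weight_subst.hom_sum coeff_sum)
  thus ?thesis
    unfolding P[symmetric] c_def k_def .
qed

lemma coeff_dehomogenize:
  assumes "homogeneous3 d G"
  shows "coeff2 (poly G 1) i j = (if i + j \<le> d then coeff3 G i j (d - i - j) else 0)"
proof -
  have "coeff2 (poly G 1) i j = (\<Sum>k\<le>degree G. coeff3 G i j k)"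
    by (simp add: poly_altdef coeff_sum)
  also have "\<dots> = (\<Sum>k\<le>degree G. if k = d - i - j \<and> i + j \<le> d then coeff3 G i j k else 0)"
  proof (intro sum.cong refl)
    fix k
    have "i + j + k = d" if "coeff3 G i j k \<noteq> 0"
      using assms that unfolding homogeneous3_def by blast
    thus "coeff3 G i j k = (if k = d - i - j \<and> i + j \<le> d then coeff3 G i j k else 0)"
      by (cases "coeff3 G i j k = 0") auto
  qed
  also have "\<dots> = (if i + j \<le> d then coeff3 G i j (d - i - j) else 0)"
    by (auto simp: coeff_eq_0)
  finally show ?thesis .
qed

text \<open>
  A monomial \<open>t ^ i y ^ j\<close> with \<open>i + j \<le> d\<close> has weight \<open>3 i + 4 j \<le> 4 d\<close>, with equality only
  for \<open>y ^ d\<close>. The coefficient of \<open>y ^ d\<close> is also the value of the form \<open>G\<close> at \<open>[0 : 1 : 0]\<close>.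
\<close>

lemma degree_weight_subst_le:
  assumes "homogeneous3 d G"
  shows "degree (weight_subst (poly G 1)) \<le> 4 * d"
proof (rule degree_le, intro allI impI)
  fix n
  assume "4 * d < n"
  hence "coeff2 (weight_subst (poly G 1)) m n = 0" for m
    unfolding coeff_weight_subst coeff_dehomogenize[OF assms] by (auto elim!: dvdE)
  thus "coeff (weight_subst (poly G 1)) n = 0"
    by (simp add: poly_eq_iff)
qed

lemma coeff_weight_subst_top:
  assumes "homogeneous3 d G"
  shows "coeff (weight_subst (poly G 1)) (4 * d) = monom (coeff3 G 0 d 0) d"
proof (rule poly_eqI)
  fix m
  show "coeff2 (weight_subst (poly G 1)) m (4 * d) = coeff (monom (coeff3 G 0 d 0) d) m"
  proof (cases "m = d")
    case True
    thus ?thesis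
      unfolding coeff_weight_subst coeff_dehomogenize[OF assms] by simp
  next
    case False
    thus ?thesis
      unfolding coeff_weight_subst coeff_dehomogenize[OF assms] by (auto elim!: dvdE)
  qed
qed

lemma eval3_infinite:
  assumes "homogeneous3 d G"
  shows "eval3 G (0, 1, 0) = coeff3 G 0 d 0"
proof -
  have "eval3 G (0, 1, 0) = (\<Sum>j\<le>degree (coeff G 0). coeff3 G 0 j 0)"
    by (simp add: eval3_def poly_0_coeff_0 poly_altdef[of "coeff G 0"] coeff_sum flip: one_pCons)
  also have "\<dots> = (\<Sum>j\<le>degree (coeff G 0). if j = d then coeff3 G 0 j 0 else 0)"
  proof (intro sum.cong refl)
    fix j
    have "0 + j + 0 = d" if "coeff3 G 0 j 0 \<noteq> 0"
      using assms that unfolding homogeneous3_def by blast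
    thus "coeff3 G 0 j 0 = (if j = d then coeff3 G 0 j 0 else 0)"
      by auto
  qed
  also have "\<dots> = coeff3 G 0 d 0"
    by (simp add: coeff_eq_0)
  finally show ?thesis .
qed

text \<open>
  Suppose that \<open>G / H\<close> represents \<open>1 / (t - c)\<close>, with \<open>G\<close> and \<open>H\<close> of degree \<open>d\<close>, and that
  \<open>g = G(0, 1, 0)\<close> is nonzero. The polynomial \<open>H - G (t - c)\<close> then has leading form
  \<open>- g t y ^ d\<close>, of weight \<open>4 d + 3\<close>, since \<open>H\<close> only reaches weight \<open>4 d\<close>. But it is a multiple of
  \<open>y ^ 3 - q(t)\<close>, so its leading form is a multiple of \<open>y ^ 3 - t ^ 4\<close> and vanishes at
  \<open>t = y = 1\<close>, a contradiction.
\<close>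

lemma value_at_infinite_point:
  fixes q :: "'a::field poly"
  assumes q: "degree q = 4" "lead_coeff q = 1"
    and v: "has_value_at (cubic_cover q) (inverse_t_minus c) infinite_point v"
  shows "v = 0"
proof -
  obtain d G H where
    G: "homogeneous3 d G" and H: "homogeneous3 d H" and
    dvd: "cubic_cover q dvd poly H 1 - poly G 1 * t_minus c" and
    val: "\<And>z. z \<in> infinite_point \<Longrightarrow> v = eval3 G z / eval3 H z"
    using v by (auto simp: has_value_at_def inverse_t_minus_def)
  define g where "g = coeff3 G 0 d 0"
  define D where "D = weight_subst (poly H 1 - poly G 1 * t_minus c)"
  define F where "F = weight_subst (cubic_cover q)"
  obtain K where K: "D = F * K"
    using dvd unfolding D_def F_def by (metis dvdE weight_subst.hom_mult)
  have "t_minus c = monom (monom 1 1) 0 - monom (monom c 0) 0"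
    by (simp add: t_minus_def monom_0 monom_Suc)
  hence weight_t: "weight_subst (t_minus c) = monom 1 3 - [:[:c:]:]"
    by (simp only: weight_subst.hom_minus weight_subst_monom) (simp add: monom_0)
  have D: "D = weight_subst (poly H 1) - monom 1 3 * weight_subst (poly G 1)
      + smult [:c:] (weight_subst (poly G 1))"
    unfolding D_def weight_subst.hom_minus weight_subst.hom_mult weight_t by (simp add: algebra_simps)
  have "cubic_cover q = monom (monom 1 0) 3 - monom q 0"
    by (simp add: monom_0 monom_Suc numeral_3_eq_3 one_pCons)
  hence F: "F = monom (monom 1 3) 12 - weight_subst (monom q 0)"
    by (simp only: F_def weight_subst.hom_minus weight_subst_monom) simp
  have q_coeff: "coeff q i = 0" if "i > 4" for i
    using that q by (simp add: coeff_eq_0)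
  have deg_q: "degree (weight_subst (monom q 0)) \<le> 12"
  proof (rule degree_le, intro allI impI)
    fix n :: nat
    assume "12 < n"
    thus "coeff (weight_subst (monom q 0)) n = 0"
      by (intro poly_eqI) (auto simp: coeff_weight_subst q_coeff elim!: dvdE)
  qed
  have coeff_q: "coeff (weight_subst (monom q 0)) 12 = 1"
    using q by (intro poly_eqI) (auto simp: coeff_weight_subst coeff_1)
  \<comment> \<open>The leading form is \<open>y ^ 3 - t ^ 4\<close>, as \<open>q\<close> is monic of degree 4.\<close>
  have coeff_F: "coeff F 12 = monom 1 3 - 1"
    by (simp add: F coeff_q)
  have "coeff (coeff F 12) 3 = 1"
    by (simp add: coeff_F)
  hence "coeff F 12 \<noteq> 0"
    by auto
  moreover have "degree F \<le> 12"
    unfolding F using deg_q by (intro degree_diff_le) (auto simp: degree_monom_le)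
  ultimately have "degree F = 12"
    by (meson le_antisym le_degree)
  hence lead_F: "poly (lead_coeff F) 1 = 0"
    by (simp add: coeff_F poly_monom)
  have "g = 0"
  proof (rule ccontr)
    assume "g \<noteq> 0"
    have deg_D: "degree D \<le> 4 * d + 3"
    proof -
      have "degree (monom 1 3 * weight_subst (poly G 1)) \<le> 3 + 4 * d"
        by (rule order.trans[OF degree_mult_le])
           (intro add_mono degree_monom_le degree_weight_subst_le[OF G])
      moreover have "degree (smult [:c:] (weight_subst (poly G 1))) \<le> 4 * d"
        using degree_smult_le degree_weight_subst_le[OF G] by (rule order.trans)
      ultimately show ?thesis
        unfolding D using degree_weight_subst_le[OF H]
        by (intro degree_add_le degree_diff_le) auto
    qed
    have top: "coeff D (4 * d + 3) = - monom g d"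
    proof -
      have "coeff (weight_subst (poly H 1)) (4 * d + 3) = 0"
        using degree_weight_subst_le[OF H] by (intro coeff_eq_0) simp
      moreover have "coeff (weight_subst (poly G 1)) (4 * d + 3) = 0"
        using degree_weight_subst_le[OF G] by (intro coeff_eq_0) simp
      ultimately show ?thesis
        by (simp add: D coeff_monom_mult coeff_weight_subst_top[OF G] g_def)
    qed
    hence "coeff D (4 * d + 3) \<noteq> 0"
      using \<open>g \<noteq> 0\<close> by simp
    with deg_D have "degree D = 4 * d + 3"
      by (meson le_antisym le_degree)
    hence "poly (lead_coeff D) 1 = - g"
      by (simp add: top poly_monom)
    moreover have "poly (lead_coeff D) 1 = 0"
      unfolding K lead_coeff_mult poly_mult lead_F by simp
    ultimately show False
      using \<open>g \<noteq> 0\<close> by simp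
  qed
  moreover have "(0, 1, 0) \<in> (infinite_point :: ('a \<times> 'a \<times> 'a) set)"
    by (auto simp: infinite_point_eq)
  ultimately show ?thesis
    using val eval3_infinite[OF G] by (simp add: g_def)
qed

section \<open>The integral as a sum over the line\<close>

text \<open>
  Every omitted point may be counted with value zero: the points with \<open>a = c\<close> because
  \<open>1 / 0 = 0\<close>, and the point at infinity because its value can only be zero. This makes it
  unnecessary to decide whether the function is regular at infinity.
\<close>

lemma curve_integral_cubic_cover:
  fixes q :: "'a::{field, finite} poly"
  assumes q: "degree q = 4" "lead_coeff q = 1"
  shows "curve_integral (cubic_cover q) (inverse_t_minus c) =
    (\<Sum>a\<in>UNIV. of_nat (card {b. b ^ 3 = poly q a}) / (a - c))"
proof -
  let ?f = "cubic_cover q" and ?r = "inverse_t_minus c"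
  let ?A = "{(a, b). b ^ 3 = poly q a}"
  define val where "val P = (if regular_at ?f ?r P then value_at ?f ?r P else 0)" for P
  have val_infinite: "val infinite_point = 0"
  proof (cases "regular_at ?f ?r infinite_point")
    case True
    then obtain v where v: "has_value_at ?f ?r infinite_point v"
      by (auto simp: regular_at_def)
    have "value_at ?f ?r infinite_point = v"
      unfolding value_at_def
      by (rule the_equality) (use v value_at_infinite_point[OF q] in auto)
    with value_at_infinite_point[OF q v] show ?thesis
      by (simp add: val_def)
  qed (simp add: val_def)
  have val_affine: "val (affine_point a b) = 1 / (a - c)" if "b ^ 3 = poly q a" for a b
    by (simp add: val_def regular_at_def value_at_def has_value_at_affine_point[OF that])
  have "finite (closure_points ?f)"
    by (simp add: closure_points_cubic_cover[OF q(1)])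
  hence "curve_integral ?f ?r = (\<Sum>P\<in>closure_points ?f. val P)"
    unfolding curve_integral_def
    by (intro sum.mono_neutral_cong_left) (auto simp: val_def)
  also have "\<dots> = (\<Sum>P\<in>(\<lambda>(a, b). affine_point a b) ` ?A. val P)"
    unfolding closure_points_cubic_cover[OF q(1)]
    using affine_neq_infinite_point by (subst sum.insert) (auto simp: val_infinite)
  also have "\<dots> = (\<Sum>(a, b)\<in>?A. 1 / (a - c))"
    by (subst sum.reindex)
       (auto simp: inj_on_def affine_point_inject val_affine intro!: sum.cong)
  also have "?A = (SIGMA a:UNIV. {b. b ^ 3 = poly q a})"
    by auto
  also have "(\<Sum>(a, b)\<in>\<dots>. 1 / (a - c)) = (\<Sum>a\<in>UNIV. \<Sum>b | b ^ 3 = poly q a. 1 / (a - c))"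
    by (rule sum.Sigma[symmetric]) auto
  also have "\<dots> = (\<Sum>a\<in>UNIV. of_nat (card {b. b ^ 3 = poly q a}) / (a - c))"
    by simp
  finally show ?thesis .
qed

lemma curve_eq_cubic_cover:
  "curve_eq x = cubic_cover (linear_product x (\<lambda>i. if i = 3 then 2 else 1))"
proof -
  have "t_minus (x 1) * t_minus (x 2) * t_minus (x 3) ^ 2 =
      [:linear_product x (\<lambda>i. if i = 3 then 2 else 1):]"
    by (simp add: t_minus_def linear_product_def power2_eq_square algebra_simps)
  thus ?thesis
    by (simp add: curve_eq_def power3_eq_cube)
qed

theorem theorem1p6:
  fixes p j :: nat and x :: "nat \<Rightarrow> 'a::prime_card mod_ring"
  assumes "p = CARD('a)" and "prime p" and "3 dvd p - 1"
    and "x 1 \<noteq> x 2" and "x 1 \<noteq> x 3" and "x 2 \<noteq> x 3"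
    and "j \<in> {1, 2, 3}"
  shows "curve_integral (curve_eq x) (inverse_t_minus (x j)) =
    - eval3 (kz_b (p - 1) j) (x 1, x 2, x 3) - eval3 (kz_c (p - 1) j) (x 1, x 2, x 3)"
proof -
  define r where "r = (p - 1) div 3"
  have r: "CARD('a) - 1 = 3 * r"
    using assms by (simp add: r_def)
  have p: "p = Suc (3 * r)"
    using r assms(1) prime_gt_0_nat[OF assms(2)] by linarith
  \<comment> \<open>Neither 1 nor 4 is prime, so \<open>r \<ge> 2\<close>, as the division by \<open>t - x j\<close> requires.\<close>
  have "r \<noteq> 0"
    using prime_gt_1_nat[OF assms(2)] by (auto simp: p)
  moreover have "r \<noteq> 1"
  proof
    assume "r = 1"
    hence "2 dvd p"
      by (simp add: p)
    thus False
      using assms(2) \<open>r = 1\<close> primes_dvd_imp_eq[OF two_is_prime_nat assms(2)] by (simp add: p)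
  qed
  ultimately have r2: "r \<ge> 2"
    by simp
  define e eb ec :: "nat \<Rightarrow> nat" where
    "e = (\<lambda>i. if i = 3 then 2 else 1)" and
    "eb = (\<lambda>i. if i = 3 then 2 * r else r)" and
    "ec = (\<lambda>i. if i = 3 then r else 2 * r)"
  define q where "q = linear_product x e"
  have b: "poly q a ^ r = poly (linear_product x eb) a" for a
    by (simp add: q_def poly_linear_product e_def eb_def power_mult_distrib flip: power_mult)
  have c: "poly q a ^ (2 * r) = poly (linear_product x ec) a" for a
  proof -
    have "(a - x 3) ^ (3 * r) * (a - x 3) ^ r = (a - x 3) ^ r"
      using fermat_mod_ring[of "a - x 3", unfolded r] r2 by (cases "a = x 3") simp_all
    hence "(a - x 3) ^ (2 * (2 * r)) = (a - x 3) ^ r"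
      by (simp flip: power_add)
    thus ?thesis
      by (simp add: q_def poly_linear_product e_def ec_def power_mult_distrib flip: power_mult)
  qed
  have kz_b: "eval3 (kz_b (p - 1) j) (x 1, x 2, x 3) = specialize (x 1, x 2, x 3)
      (coeff (linear_product var3 eb div [:- var3 j, 1:]) (CARD('a) - 1))"
    by (simp add: kz_b_def specialize_def b_bar_def linear_product_def eb_def r_def assms(1) mult_ac)
  have kz_c: "eval3 (kz_c (p - 1) j) (x 1, x 2, x 3) = specialize (x 1, x 2, x 3)
      (coeff (linear_product var3 ec div [:- var3 j, 1:]) (CARD('a) - 1))"
    by (simp add: kz_c_def specialize_def c_bar_def linear_product_def ec_def r_def assms(1) mult_ac)
  have "curve_integral (curve_eq x) (inverse_t_minus (x j)) =
      (\<Sum>a\<in>UNIV. of_nat (card {b. b ^ 3 = poly q a}) / (a - x j))"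
    unfolding curve_eq_cubic_cover q_def e_def
    by (intro curve_integral_cubic_cover degree_linear_product[THEN trans]
        lead_coeff_linear_product) simp
  also have "\<dots> = (\<Sum>a\<in>UNIV. 1 / (a - x j)) +
      (\<Sum>a\<in>UNIV. poly (linear_product x eb) a / (a - x j)) +
      (\<Sum>a\<in>UNIV. poly (linear_product x ec) a / (a - x j))"
    by (simp only: card_cube_roots[OF r] b c add_divide_distrib sum.distrib)
  also have "(\<Sum>a\<in>UNIV. 1 / (a - x j)) = 0"
    using r r2 by (intro sum_inverse_mod_ring) simp
  also have "(\<Sum>a\<in>UNIV. poly (linear_product x eb) a / (a - x j)) =
      - eval3 (kz_b (p - 1) j) (x 1, x 2, x 3)"
    unfolding kz_b using assms(7) r2 r by (intro sum_linear_product_div) (auto simp: eb_def)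
  also have "(\<Sum>a\<in>UNIV. poly (linear_product x ec) a / (a - x j)) =
      - eval3 (kz_c (p - 1) j) (x 1, x 2, x 3)"
    unfolding kz_c using assms(7) r2 r by (intro sum_linear_product_div) (auto simp: ec_def)
  finally show ?thesis
    by simp
qed

end
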